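(* Let $L>0$, $N\ge 1$, $d\ge 1$. Let $\{u_i\}_{i=0}^N$ and $\{v_i\}_{i=0}^N$ be sequences of positive real numbers related by $v_i=\frac{1}{u_{N-i}}$ for $i=0,\dots,N$, and set $u_{-1}=0$. Let $H\in\mathbb{R}^{N\times N}$ be lower triangular, with entries written $h_{k+1,i}=H_{k+1,i+1}$ for $0\le i\le k\le N-1$, and let $K=H^A$ be its anti-transpose, i.e. $(H^A)_{i,j}=H_{N-j+1,N-i+1}$ for $i,j=1,\dots,N$, with entries written $k_{m+1,i}=K_{m+1,i+1}$ for $0\le i\le m\le N-1$. Then the following two statements are equivalent. (a) For all $x_0,x_\star\in\mathbb{R}^d$, all vectors $g_0,\dots,g_N\in\mathbb{R}^d$ and all reals $f_0,\dots,f_N,f_\star$, with $x_{k+1}=x_k-\frac1L\sum_{i=0}^k h_{k+1,i}g_i$ for $0\le k\le N-1$, one has $u_N(f_N-f_\star)\le\mathcal{U}_N$, where $$\mathcal U_N=\frac L2\|x_0-x_\star\|^2+\sum_{i=0}^{N-1}u_i\Big(f_{i+1}-f_i+\langle g_{i+1},x_i-x_{i+1}\rangle+\frac1{2L}\|g_i-g_{i+1}\|^2\Big)+\sum_{i=0}^N(u_i-u_{i-1})\Big(f_i-f_\star+\langle g_i,x_\star-x_i\rangle+\frac1{2L}\|g_i\|^2\Big).$$ (b) For all $y_0\in\mathbb{R}^d$, all vectors $g_0,\dots,g_N\in\mathbb{R}^d$ and all reals $f_0,\dots,f_N,f_\star$, with $y_{m+1}=y_m-\frac1L\sum_{i=0}^m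 k_{m+1,i}g_i$ for $0\le m\le N-1$, one has $\frac1{2L}\|g_N\|^2\le\mathcal V_N$, where $$\mathcal V_N=v_0\Big(f_0-f_\star+f_\star-f_N+\frac1{2L}\|g_N\|^2\Big)+\sum_{i=0}^{N-1}v_{i+1}\Big(f_{i+1}-f_i+\langle g_{i+1},y_i-y_{i+1}\rangle+\frac1{2L}\|g_i-g_{i+1}\|^2\Big)+\sum_{i=0}^{N-1}(v_{i+1}-v_i)\Big(f_i-f_N+\langle g_i,y_N-y_i\rangle+\frac1{2L}\|g_i-g_N\|^2\Big).$$
   Context: The fixed-step first-order method (FSFOM) with a lower triangular matrix $H\in\mathbb{R}^{N\times N}$, identified with stepsizes $h_{k+1,i}=H_{k+1,i+1}$ for $0\le i\le k\le N-1$, is $x_{k+1}=x_k-\frac1L\sum_{i=0}^k h_{k+1,i}\nabla f(x_i)$, $k=0,\dots,N-1$. In the inequality $u_N(f_N-f_\star)\le\mathcal U_N$, the vectors $g_0,\dots,g_N$ stand for $\nabla f(x_0),\dots,\nabla f(x_N)$ and the reals $f_0,\dots,f_N,f_\star$ stand for $f(x_0),\dots,f(x_N),f_\star$, where $x_0,\dots,x_N$ are the iterates of the FSFOM with $H$. In the inequality $\frac1{2L}\|g_N\|^2\le\mathcal V_N$, the vectors $g_0,\dots,g_N$ stand for $\nabla f(y_0),\dots,\nabla f(y_N)$ and the reals $f_0,\dots,f_N,f_\star$ stand for $f(y_0),\dots,f(y_N),f_\star$, where $y_0,\dots,y_N$ are the iterates of the FSFOM with $H^A$. In both inequalities the gradients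 at the iterates are treated as arbitrary vectors of $\mathbb{R}^d$ (not necessarily gradients of a common function) and the function values as arbitrary reals (all function values cancel in the inequalities). *)

theory Defs
  imports "HOL-Analysis.Analysis"
begin

text \<open>
  An \<open>N \<times> N\<close> real matrix is a function \<open>nat \<Rightarrow> nat \<Rightarrow> real\<close> with rows and columns numbered
  \<open>1, \<dots>, N\<close>; values outside this range play no role. The stepsizes are
  \<open>h k i = H k (i + 1)\<close>, as the second index of the stepsizes starts from \<open>0\<close>.
\<close>

definition lower_triangular :: "nat \<Rightarrow> (nat \<Rightarrow> nat \<Rightarrow> real) \<Rightarrow> bool" where
  "lower_triangular N H \<longleftrightarrow> (\<forall>i\<in>{1..N}. \<forall>j\<in>{1..N}. i < j \<longrightarrow> H i j = 0)"

definition anti_transpose :: "nat \<Rightarrow> (nat \<Rightarrow> nat \<Rightarrow> real) \<Rightarrow> nat \<Rightarrow> nat \<Rightarrow> real" where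
  "anti_transpose N H i j = H (N - j + 1) (N - i + 1)"

definition stepsize :: "(nat \<Rightarrow> nat \<Rightarrow> real) \<Rightarrow> nat \<Rightarrow> nat \<Rightarrow> real" where
  "stepsize H k i = H k (i + 1)"

text \<open>
  Iterates of the fixed-step first-order method started at \<open>x0\<close>, where \<open>g i\<close> takes the place of
  the gradient at the \<open>i\<close>-th iterate. For an \<open>N \<times> N\<close> matrix only the iterates
  \<open>0, \<dots>, N\<close> are meaningful.
\<close>

primrec fsfom ::
  "real \<Rightarrow> (nat \<Rightarrow> nat \<Rightarrow> real) \<Rightarrow> (nat \<Rightarrow> 'a::real_inner) \<Rightarrow> 'a \<Rightarrow> nat \<Rightarrow> 'a" where
  "fsfom L H g x0 0 = x0"
| "fsfom L H g x0 (Suc k) =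
     fsfom L H g x0 k - (1 / L) *\<^sub>R (\<Sum>i=0..k. stepsize H (k + 1) i *\<^sub>R g i)"

text \<open>The conditional below implements the convention \<open>u\<^sub>-\<^sub>1 = 0\<close>.\<close>

definition U_bound ::
  "real \<Rightarrow> nat \<Rightarrow> (nat \<Rightarrow> real) \<Rightarrow> (nat \<Rightarrow> 'a::real_inner) \<Rightarrow> 'a \<Rightarrow> (nat \<Rightarrow> 'a) \<Rightarrow>
   (nat \<Rightarrow> real) \<Rightarrow> real \<Rightarrow> real" where
  "U_bound L N u x xs g f fs =
     L / 2 * (norm (x 0 - xs))\<^sup>2
     + (\<Sum>i=0..<N. u i *
          (f (i + 1) - f i + g (i + 1) \<bullet> (x i - x (i + 1))
           + 1 / (2 * L) * (norm (g i - g (i + 1)))\<^sup>2))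
     + (\<Sum>i=0..N. (u i - (if i = 0 then 0 else u (i - 1))) *
          (f i - fs + g i \<bullet> (xs - x i) + 1 / (2 * L) * (norm (g i))\<^sup>2))"

definition V_bound ::
  "real \<Rightarrow> nat \<Rightarrow> (nat \<Rightarrow> real) \<Rightarrow> (nat \<Rightarrow> 'a::real_inner) \<Rightarrow> (nat \<Rightarrow> 'a) \<Rightarrow>
   (nat \<Rightarrow> real) \<Rightarrow> real \<Rightarrow> real" where
  "V_bound L N v y g f fs =
     v 0 * (f 0 - fs + fs - f N + 1 / (2 * L) * (norm (g N))\<^sup>2)
     + (\<Sum>i=0..<N. v (i + 1) *
          (f (i + 1) - f i + g (i + 1) \<bullet> (y i - y (i + 1))
           + 1 / (2 * L) * (norm (g i - g (i + 1)))\<^sup>2))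
     + (\<Sum>i=0..<N. (v (i + 1) - v i) *
          (f i - f N + g i \<bullet> (y N - y i) + 1 / (2 * L) * (norm (g i - g N))\<^sup>2))"

end

theory Submission
  imports Defs
begin

text \<open>
  In both inequalities the function values cancel. Write \<open>g\<close> for the gradients in (a) and \<open>\<gamma>\<close> for
  those in (b), and let \<open>\<gamma> 0 = u N g N\<close> and \<open>\<gamma> (N - k) - \<gamma> (N - k - 1) = u k (g k - g (k + 1))\<close>.
  Since \<open>v i = 1 / u (N - i)\<close>, this is a bijective change of variables. Summation by parts turns
  the terms of (a) that contain iterates into \<open>\<Sum>k. \<gamma> (N - k - 1) \<bullet> (x k - x (k + 1))\<close>
  and those of (b) into \<open>\<Sum>m. g (N - m - 1) \<bullet> (y m - y (m + 1))\<close>, and these two bilinear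
  forms agree exactly when the step matrices are anti-transposes of each other. The remaining
  quadratic terms agree as well, up to the square \<open>L / 2 * (norm (x0 - xs - \<gamma> N / L))\<^sup>2\<close>, which
  vanishes for a suitable \<open>xs\<close>.
\<close>

section \<open>Change of variables between the two gradient sequences\<close>

definition dual_gradients ::
  "nat \<Rightarrow> (nat \<Rightarrow> real) \<Rightarrow> (nat \<Rightarrow> 'a::real_vector) \<Rightarrow> (nat \<Rightarrow> 'a) \<Rightarrow> bool" where
  "dual_gradients N u g \<gamma> \<longleftrightarrow>
     \<gamma> 0 = u N *\<^sub>R g N \<and>
     (\<forall>k<N. \<gamma> (N - k) - \<gamma> (N - Suc k) = u k *\<^sub>R (g k - g (Suc k)))"

text \<open>The increments telescope upward from \<open>\<gamma> 0\<close>. This serves the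
  direction from (b) to (a), where \<open>g\<close> is given.\<close>

lemma dual_gradients_right_exists: "\<exists>\<gamma>. dual_gradients N u g \<gamma>"
proof -
  define \<gamma> where "\<gamma> m = u N *\<^sub>R g N + (\<Sum>i\<in>{N - m..<N}. u i *\<^sub>R (g i - g (Suc i)))" for m
  have "\<gamma> (N - k) - \<gamma> (N - Suc k) = u k *\<^sub>R (g k - g (Suc k))" if "k < N" for k
    using that by (simp add: \<gamma>_def sum.atLeast_Suc_lessThan)
  moreover have "\<gamma> 0 = u N *\<^sub>R g N"
    by (simp add: \<gamma>_def)
  ultimately show ?thesis
    unfolding dual_gradients_def by blast
qed

text \<open>Solving downward from \<open>g N\<close> divides each increment by \<open>u i\<close>.
  This serves the direction from (a) to (b), where \<open>\<gamma>\<close> is given.\<close>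

lemma dual_gradients_left_exists:
  assumes "\<And>i. i \<le> N \<Longrightarrow> u i \<noteq> 0"
  shows "\<exists>g. dual_gradients N u g \<gamma>"
proof -
  define g where "g k = (1 / u N) *\<^sub>R \<gamma> 0
    + (\<Sum>i\<in>{k..<N}. (1 / u i) *\<^sub>R (\<gamma> (N - i) - \<gamma> (N - Suc i)))" for k
  have "\<gamma> (N - k) - \<gamma> (N - Suc k) = u k *\<^sub>R (g k - g (Suc k))" if "k < N" for k
    using that assms by (simp add: g_def sum.atLeast_Suc_lessThan)
  moreover have "\<gamma> 0 = u N *\<^sub>R g N"
    using assms by (simp add: g_def)
  ultimately show ?thesis
    unfolding dual_gradients_def by blast
qed

section \<open>Summation by parts in both bounds\<close>

lemma sum_by_parts_lower:
  fixes a :: "nat \<Rightarrow> real"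
  shows "(\<Sum>i<n. u i * (a (Suc i) - a i))
    + (\<Sum>i\<le>n. (u i - (if i = 0 then 0 else u (i - 1))) * a i) = u n * a n"
  by (induction n) (simp_all add: algebra_simps)

lemma sum_by_parts_upper:
  fixes v :: "nat \<Rightarrow> real"
  shows "v 0 * a 0 + (\<Sum>i<n. v (Suc i) * (a (Suc i) - a i)) + (\<Sum>i<n. (v (Suc i) - v i) * a i)
    = v n * a n"
  by (induction n) (simp_all add: algebra_simps)

text \<open>\<open>s k\<close> stands for \<open>\<gamma> (N - k)\<close>, so that the recursion
  runs along the iterates. Unrolled, \<open>s k\<close> is \<open>u k *\<^sub>R g k\<close> plus the
  sum of \<open>(u i - u (i - 1)) *\<^sub>R g i\<close> over \<open>k < i \<le> N\<close>. Hence
  \<open>s 0\<close> collects all that is paired with \<open>xs\<close>, and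
  \<open>s (Suc k)\<close> all that is paired with \<open>x k - x (Suc k)\<close>.\<close>

lemma U_bound_eq:
  fixes g :: "nat \<Rightarrow> 'a::real_inner"
  assumes sN: "s N = u N *\<^sub>R g N"
    and step: "\<And>k. k < N \<Longrightarrow> s k - s (Suc k) = u k *\<^sub>R (g k - g (Suc k))"
  shows "U_bound L N u x xs g f fs = u N * (f N - fs)
    + L / 2 * (norm (x 0 - xs))\<^sup>2 + s 0 \<bullet> (xs - x 0)
    + (\<Sum>k<N. s (Suc k) \<bullet> (x k - x (Suc k)))
    + 1 / (2 * L) * (s N \<bullet> g N + 2 * (\<Sum>k<N. (s k - s (Suc k)) \<bullet> g k))"
proof -
  define D where "D i = u i - (if i = 0 then 0 else u (i - 1))" for i
  have D_simps: "D 0 = u 0" "\<And>i. D (Suc i) = u (Suc i) - u i"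
    by (simp_all add: D_def)
  have s_Suc: "s (Suc n) = s n - u n *\<^sub>R (g n - g (Suc n))" if "n < N" for n
    using step[OF that] by (simp add: algebra_simps)
  have parts: "(\<Sum>i\<le>n. D i * a i) = u n * a n - (\<Sum>i<n. u i * (a (Suc i) - a i))"
    for n and a :: "nat \<Rightarrow> real"
    using sum_by_parts_lower[of u a n] by (simp add: D_def)
  have fun_values: "(\<Sum>i<N. u i * (f (Suc i) - f i)) + (\<Sum>i\<le>N. D i * (f i - fs)) = u N * (f N - fs)"
    using parts[of "\<lambda>i. f i - fs" N] by simp
  \<comment> \<open>Prefixes leave the boundary term
    \<open>u n * (g n \<bullet> xs) - s n \<bullet> xs\<close>, which vanishes at
    \<open>n = N\<close> by \<open>sN\<close>.\<close>
  have "(\<Sum>i\<le>n. D i * (g i \<bullet> xs)) = u n * (g n \<bullet> xs) + s 0 \<bullet> xs - s n \<bullet> xs" if "n \<le> N" for n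
    using that
  proof (induction n)
    case (Suc n)
    then show ?case
      by (simp add: s_Suc D_simps algebra_simps inner_simps)
  qed (simp add: D_simps)
  from this[of N] have xs: "(\<Sum>i\<le>N. D i * (g i \<bullet> xs)) = s 0 \<bullet> xs"
    by (simp add: sN)
  \<comment> \<open>Again the boundary terms containing \<open>x n\<close> cancel at
    \<open>n = N\<close>.\<close>
  have "(\<Sum>i<n. u i * (g (Suc i) \<bullet> (x i - x (Suc i)))) - (\<Sum>i\<le>n. D i * (g i \<bullet> x i))
      = (\<Sum>i<n. s (Suc i) \<bullet> (x i - x (Suc i))) - s 0 \<bullet> x 0 + s n \<bullet> x n - u n * (g n \<bullet> x n)"
    if "n \<le> N" for n
    using that
  proof (induction n)
    case (Suc n)
    then show ?case
      by (simp add: s_Suc D_simps algebra_simps inner_simps)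
  qed (simp add: D_simps)
  from this[of N] have iterates:
    "(\<Sum>i<N. u i * (g (Suc i) \<bullet> (x i - x (Suc i)))) - (\<Sum>i\<le>N. D i * (g i \<bullet> x i))
      = (\<Sum>i<N. s (Suc i) \<bullet> (x i - x (Suc i))) - s 0 \<bullet> x 0"
    by (simp add: sN)
  have "(\<Sum>i<N. u i * (norm (g i - g (Suc i)))\<^sup>2) + (\<Sum>i\<le>N. D i * (norm (g i))\<^sup>2)
      = s N \<bullet> g N + (\<Sum>i<N. u i * ((norm (g i - g (Suc i)))\<^sup>2 + (norm (g i))\<^sup>2 - (norm (g (Suc i)))\<^sup>2))"
    unfolding parts sN right_diff_distrib distrib_left sum.distrib sum_subtractf
    by (simp add: power2_norm_eq_inner)
  \<comment> \<open>Polarization: |a - b|^2 + |a|^2 - |b|^2 = 2 (a - b) \<bullet> a, with a =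
    \<open>g i\<close> and b = \<open>g (Suc i)\<close>.\<close>
  also have "(\<Sum>i<N. u i * ((norm (g i - g (Suc i)))\<^sup>2 + (norm (g i))\<^sup>2 - (norm (g (Suc i)))\<^sup>2))
      = (\<Sum>i<N. 2 * ((s i - s (Suc i)) \<bullet> g i))"
    by (intro sum.cong) (simp_all add: step power2_norm_eq_inner algebra_simps inner_simps inner_commute)
  finally have squares:
    "(\<Sum>i<N. u i * (norm (g i - g (Suc i)))\<^sup>2) + (\<Sum>i\<le>N. D i * (norm (g i))\<^sup>2)
      = s N \<bullet> g N + 2 * (\<Sum>i<N. (s i - s (Suc i)) \<bullet> g i)"
    by (simp add: sum_distrib_left)
  have "U_bound L N u x xs g f fs = L / 2 * (norm (x 0 - xs))\<^sup>2
      + ((\<Sum>i<N. u i * (f (Suc i) - f i)) + (\<Sum>i\<le>N. D i * (f i - fs)))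
      + (\<Sum>i\<le>N. D i * (g i \<bullet> xs))
      + ((\<Sum>i<N. u i * (g (Suc i) \<bullet> (x i - x (Suc i)))) - (\<Sum>i\<le>N. D i * (g i \<bullet> x i)))
      + 1 / (2 * L) * ((\<Sum>i<N. u i * (norm (g i - g (Suc i)))\<^sup>2) + (\<Sum>i\<le>N. D i * (norm (g i))\<^sup>2))"
    unfolding U_bound_def D_def[symmetric] atLeast0LessThan atLeast0AtMost Suc_eq_plus1[symmetric]
      distrib_left inner_diff_right right_diff_distrib sum.distrib sum_subtractf sum_distrib_left
    by (simp add: algebra_simps)
  then show ?thesis
    unfolding fun_values xs iterates squares by (simp add: inner_diff_right)
qed

text \<open>\<open>G m\<close> stands for \<open>g (N - m)\<close>, and the assumptions are the
  inverse change of variables. The closed form \<open>G_eq\<close> shows that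
  \<open>G (Suc m)\<close> is the total coefficient of \<open>y m - y (Suc m)\<close>.\<close>

lemma V_bound_eq:
  fixes \<gamma> :: "nat \<Rightarrow> 'a::real_inner"
  assumes G0: "G 0 = v 0 *\<^sub>R \<gamma> 0"
    and step: "\<And>m. m < N \<Longrightarrow> G (Suc m) - G m = v (Suc m) *\<^sub>R (\<gamma> (Suc m) - \<gamma> m)"
  shows "V_bound L N v y \<gamma> f fs = (\<Sum>m<N. G (Suc m) \<bullet> (y m - y (Suc m)))
    + 1 / (2 * L) * (\<gamma> 0 \<bullet> G 0 + 2 * (\<Sum>m<N. (\<gamma> (Suc m) - \<gamma> m) \<bullet> G (Suc m)))"
proof -
  define S where "S n = (\<Sum>i<n. (v (Suc i) - v i) *\<^sub>R \<gamma> i)" for n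
  have S_Suc: "S (Suc n) = S n + (v (Suc n) - v n) *\<^sub>R \<gamma> n" for n
    by (simp add: S_def)
  have inner_S: "S n \<bullet> z = (\<Sum>i<n. (v (Suc i) - v i) * (\<gamma> i \<bullet> z))" for n z
    by (simp add: S_def inner_sum_left)
  have G_Suc: "G (Suc n) = G n + v (Suc n) *\<^sub>R (\<gamma> (Suc n) - \<gamma> n)" if "n < N" for n
    using step[OF that] by (simp add: algebra_simps)
  have G_eq: "G n = v n *\<^sub>R \<gamma> n - S n" if "n \<le> N" for n
    using that
  proof (induction n)
    case (Suc n)
    then show ?case
      by (simp add: G_Suc S_Suc algebra_simps)
  qed (simp add: G0 S_def)
  have telescope: "(\<Sum>i<N. (v (Suc i) - v i) * c) = (v N - v 0) * c" for c
    by (simp add: sum_distrib_right[symmetric] sum_lessThan_telescope)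
  have fun_values: "v 0 * (f 0 - f N) + (\<Sum>i<N. v (Suc i) * (f (Suc i) - f i))
      + (\<Sum>i<N. (v (Suc i) - v i) * (f i - f N)) = 0"
    using sum_by_parts_upper[of v "\<lambda>i. f i - f N" N] by simp
  have "(\<Sum>i<n. v (Suc i) * (\<gamma> (Suc i) \<bullet> (y i - y (Suc i))))
      + (\<Sum>i<n. (v (Suc i) - v i) * (\<gamma> i \<bullet> (y n - y i)))
      = (\<Sum>i<n. G (Suc i) \<bullet> (y i - y (Suc i)))" if "n \<le> N" for n
    using that
  proof (induction n)
    case (Suc n)
    \<comment> \<open>The reference point moves from \<open>y n\<close> to \<open>y (Suc n)\<close>;
      the new index \<open>i = n\<close> contributes zero to the sum taken relative to
      \<open>y n\<close>.\<close>
    have "(\<Sum>i<Suc n. (v (Suc i) - v i) * (\<gamma> i \<bullet> (y (Suc n) - y i)))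
        = (\<Sum>i<Suc n. (v (Suc i) - v i) * (\<gamma> i \<bullet> (y n - y i))) + S (Suc n) \<bullet> (y (Suc n) - y n)"
      unfolding inner_S sum.distrib[symmetric]
      by (intro sum.cong) (simp_all add: algebra_simps inner_simps)
    moreover have "G (Suc n) \<bullet> z = v (Suc n) * (\<gamma> (Suc n) \<bullet> z) - S (Suc n) \<bullet> z" for z
      using G_eq Suc.prems by (simp add: inner_diff_left)
    ultimately show ?case
      using Suc by (simp add: inner_diff_right right_diff_distrib)
  qed simp
  then have iterates: "(\<Sum>i<N. v (Suc i) * (\<gamma> (Suc i) \<bullet> (y i - y (Suc i))))
      + (\<Sum>i<N. (v (Suc i) - v i) * (\<gamma> i \<bullet> (y N - y i)))
      = (\<Sum>i<N. G (Suc i) \<bullet> (y i - y (Suc i)))"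
    by blast
  \<comment> \<open>At \<open>n = N\<close> the boundary terms are what the \<open>v 0\<close> term
    and the squares relative to \<open>\<gamma> N\<close> leave once these are expanded and
    \<open>S N\<close> is eliminated.\<close>
  have "2 * (G n \<bullet> \<gamma> n) - v n * (norm (\<gamma> n))\<^sup>2
      + (\<Sum>i<n. (v (Suc i) - v i) * (norm (\<gamma> i))\<^sup>2) + (\<Sum>i<n. v (Suc i) * (norm (\<gamma> i - \<gamma> (Suc i)))\<^sup>2)
      = \<gamma> 0 \<bullet> G 0 + 2 * (\<Sum>m<n. (\<gamma> (Suc m) - \<gamma> m) \<bullet> G (Suc m))" if "n \<le> N" for n
    using that
  proof (induction n)
    case (Suc n)
    then show ?case
      by (simp add: G_Suc power2_norm_eq_inner algebra_simps inner_simps inner_commute)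
  qed (simp add: G0 power2_norm_eq_inner)
  note this[OF order_refl]
  moreover have "(\<Sum>i<N. (v (Suc i) - v i) * (norm (\<gamma> i - \<gamma> N))\<^sup>2)
      = (\<Sum>i<N. (v (Suc i) - v i) * (norm (\<gamma> i))\<^sup>2) - 2 * (S N \<bullet> \<gamma> N)
        + (\<Sum>i<N. (v (Suc i) - v i) * (norm (\<gamma> N))\<^sup>2)"
    unfolding inner_S sum_distrib_left sum.distrib[symmetric] sum_subtractf[symmetric]
    by (intro sum.cong)
      (simp_all add: power2_norm_eq_inner algebra_simps inner_simps inner_commute)
  moreover have "S N \<bullet> \<gamma> N = v N * (norm (\<gamma> N))\<^sup>2 - G N \<bullet> \<gamma> N"
    by (simp add: G_eq power2_norm_eq_inner inner_diff_left)
  ultimately have squares: "v 0 * (norm (\<gamma> N))\<^sup>2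
      + (\<Sum>i<N. v (Suc i) * (norm (\<gamma> i - \<gamma> (Suc i)))\<^sup>2)
      + (\<Sum>i<N. (v (Suc i) - v i) * (norm (\<gamma> i - \<gamma> N))\<^sup>2)
      = \<gamma> 0 \<bullet> G 0 + 2 * (\<Sum>m<N. (\<gamma> (Suc m) - \<gamma> m) \<bullet> G (Suc m))"
    unfolding telescope left_diff_distrib[of "v N" "v 0"] by linarith
  have "V_bound L N v y \<gamma> f fs =
      (v 0 * (f 0 - f N) + (\<Sum>i<N. v (Suc i) * (f (Suc i) - f i))
        + (\<Sum>i<N. (v (Suc i) - v i) * (f i - f N)))
      + ((\<Sum>i<N. v (Suc i) * (\<gamma> (Suc i) \<bullet> (y i - y (Suc i))))
        + (\<Sum>i<N. (v (Suc i) - v i) * (\<gamma> i \<bullet> (y N - y i))))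
      + 1 / (2 * L) * (v 0 * (norm (\<gamma> N))\<^sup>2
        + (\<Sum>i<N. v (Suc i) * (norm (\<gamma> i - \<gamma> (Suc i)))\<^sup>2)
        + (\<Sum>i<N. (v (Suc i) - v i) * (norm (\<gamma> i - \<gamma> N))\<^sup>2))"
    unfolding V_bound_def atLeast0LessThan Suc_eq_plus1[symmetric]
      distrib_left sum.distrib sum_distrib_left
    by (simp add: algebra_simps diff_divide_distrib)
  then show ?thesis
    unfolding fun_values iterates squares by simp
qed

section \<open>Anti-transposed steps and the gap identity\<close>

lemma fsfom_step:
  "fsfom L H g x0 k - fsfom L H g x0 (Suc k) = (1 / L) *\<^sub>R (\<Sum>i\<le>k. H (Suc k) (Suc i) *\<^sub>R g i)"
  by (simp add: stepsize_def atLeast0AtMost)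

text \<open>Reflection in the anti-diagonal maps the index triangle onto itself.\<close>

lemma sum_triangle_anti_transpose:
  fixes F :: "nat \<Rightarrow> nat \<Rightarrow> 'b::comm_monoid_add"
  shows "(\<Sum>m<N. \<Sum>i\<le>m. F (N - Suc i) (N - Suc m)) = (\<Sum>k<N. \<Sum>j\<le>k. F k j)"
  unfolding sum.Sigma[OF finite_lessThan ballI[OF finite_atMost]]
  by (rule sum.reindex_bij_witness[where i = "\<lambda>(k, j). (N - Suc j, N - Suc k)"
        and j = "\<lambda>(m, i). (N - Suc i, N - Suc m)"]) auto

lemma bilinear_anti_transpose:
  fixes g \<gamma> :: "nat \<Rightarrow> 'a::real_inner"
  shows "(\<Sum>m<N. g (N - Suc m) \<bullet> (\<Sum>i\<le>m. anti_transpose N H (Suc m) (Suc i) *\<^sub>R \<gamma> i))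
    = (\<Sum>k<N. \<gamma> (N - Suc k) \<bullet> (\<Sum>j\<le>k. H (Suc k) (Suc j) *\<^sub>R g j))"
proof -
  \<comment> \<open>The index of \<open>\<gamma>\<close> is written as a double reversal of
    \<open>i\<close>, so that each summand has the form
    \<open>F (N - Suc i) (N - Suc m)\<close>.\<close>
  have "(\<Sum>m<N. g (N - Suc m) \<bullet> (\<Sum>i\<le>m. anti_transpose N H (Suc m) (Suc i) *\<^sub>R \<gamma> i))
      = (\<Sum>m<N. \<Sum>i\<le>m. H (Suc (N - Suc i)) (Suc (N - Suc m))
          * (\<gamma> (N - Suc (N - Suc i)) \<bullet> g (N - Suc m)))"
    by (intro sum.cong) (auto simp: inner_sum_right anti_transpose_def inner_commute intro!: sum.cong)
  also have "\<dots> = (\<Sum>k<N. \<Sum>j\<le>k. H (Suc k) (Suc j) * (\<gamma> (N - Suc k) \<bullet> g j))"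
    by (rule sum_triangle_anti_transpose)
  finally show ?thesis
    by (simp add: inner_sum_right)
qed

text \<open>Function values and starting points may differ on the two sides: the gaps depend only on
  the gradients and on \<open>x0 - xs\<close>. Completing the square in \<open>x0 - xs\<close> costs
  exactly the left-hand side of (b).\<close>

lemma U_gap_eq_V_gap:
  fixes g :: "nat \<Rightarrow> 'a::real_inner"
  assumes L: "L > 0"
    and u: "\<And>i. i \<le> N \<Longrightarrow> u i > 0"
    and v: "\<And>i. i \<le> N \<Longrightarrow> v i = 1 / u (N - i)"
    and dual: "dual_gradients N u g \<gamma>"
  shows "U_bound L N u (fsfom L H g x0) xs g f fs - u N * (f N - fs)
    = V_bound L N v (fsfom L (anti_transpose N H) \<gamma> y0) \<gamma> f' fs'
      - 1 / (2 * L) * (norm (\<gamma> N))\<^sup>2 + L / 2 * (norm (x0 - xs - (1 / L) *\<^sub>R \<gamma> N))\<^sup>2"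
proof -
  have \<gamma>0: "\<gamma> 0 = u N *\<^sub>R g N"
    and step: "\<And>k. k < N \<Longrightarrow> \<gamma> (N - k) - \<gamma> (N - Suc k) = u k *\<^sub>R (g k - g (Suc k))"
    using dual by (auto simp: dual_gradients_def)
  \<comment> \<open>This is \<open>step\<close> at \<open>k = N - Suc m\<close>, divided by
    \<open>u (N - Suc m) = 1 / v (Suc m)\<close>.\<close>
  have dual_step: "g (N - Suc m) - g (N - m) = v (Suc m) *\<^sub>R (\<gamma> (Suc m) - \<gamma> m)" if "m < N" for m
  proof -
    have "\<gamma> (Suc m) - \<gamma> m = u (N - Suc m) *\<^sub>R (g (N - Suc m) - g (N - m))"
      using step[of "N - Suc m"] that by (simp add: Suc_diff_Suc)
    moreover have "u (N - Suc m) > 0"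
      by (simp add: u)
    ultimately show ?thesis
      using that by (simp add: v)
  qed
  have U: "U_bound L N u (fsfom L H g x0) xs g f fs = u N * (f N - fs)
      + L / 2 * (norm (x0 - xs))\<^sup>2 + \<gamma> N \<bullet> (xs - x0)
      + (\<Sum>k<N. \<gamma> (N - Suc k) \<bullet> ((1 / L) *\<^sub>R (\<Sum>j\<le>k. H (Suc k) (Suc j) *\<^sub>R g j)))
      + 1 / (2 * L) * (\<gamma> 0 \<bullet> g N + 2 * (\<Sum>k<N. (\<gamma> (N - k) - \<gamma> (N - Suc k)) \<bullet> g k))"
    using U_bound_eq[where s = "\<lambda>k. \<gamma> (N - k)" and x = "fsfom L H g x0"
        and xs = xs and f = f and fs = fs, OF _ step]
    unfolding fsfom_step by (simp add: \<gamma>0)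
  have V: "V_bound L N v (fsfom L (anti_transpose N H) \<gamma> y0) \<gamma> f' fs'
      = (\<Sum>m<N. g (N - Suc m) \<bullet>
          ((1 / L) *\<^sub>R (\<Sum>i\<le>m. anti_transpose N H (Suc m) (Suc i) *\<^sub>R \<gamma> i)))
      + 1 / (2 * L) * (\<gamma> 0 \<bullet> g N + 2 * (\<Sum>m<N. (\<gamma> (Suc m) - \<gamma> m) \<bullet> g (N - Suc m)))"
    using V_bound_eq[where G = "\<lambda>m. g (N - m)" and f = f' and fs = fs'
        and y = "fsfom L (anti_transpose N H) \<gamma> y0", OF _ dual_step] u[of N]
    unfolding fsfom_step by (simp add: \<gamma>0 v)
  have "(\<Sum>m<N. (\<gamma> (Suc m) - \<gamma> m) \<bullet> g (N - Suc m))
      = (\<Sum>m<N. (\<gamma> (N - (N - Suc m)) - \<gamma> (N - Suc (N - Suc m))) \<bullet> g (N - Suc m))"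
    by (intro sum.cong) (auto simp: Suc_diff_Suc)
  also have "\<dots> = (\<Sum>k<N. (\<gamma> (N - k) - \<gamma> (N - Suc k)) \<bullet> g k)"
    by (rule sum.nat_diff_reindex)
  finally have squares: "(\<Sum>m<N. (\<gamma> (Suc m) - \<gamma> m) \<bullet> g (N - Suc m))
      = (\<Sum>k<N. (\<gamma> (N - k) - \<gamma> (N - Suc k)) \<bullet> g k)" .
  have "(norm (z - c *\<^sub>R w))\<^sup>2 = (norm z)\<^sup>2 - 2 * c * (w \<bullet> z) + c\<^sup>2 * (norm w)\<^sup>2"
    for c and z w :: 'a
    unfolding power2_norm_eq_inner
    by (simp add: inner_diff_left inner_diff_right inner_commute power2_eq_square algebra_simps)
  from this[of "x0 - xs" "1 / L" "\<gamma> N"]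
  have "(norm (x0 - xs - (1 / L) *\<^sub>R \<gamma> N))\<^sup>2
      = (norm (x0 - xs))\<^sup>2 + 2 / L * (\<gamma> N \<bullet> (xs - x0)) + 1 / (L * L) * (norm (\<gamma> N))\<^sup>2"
    using L by (simp add: inner_diff_right power_divide power2_eq_square[of L] field_simps)
  then have "L / 2 * (norm (x0 - xs - (1 / L) *\<^sub>R \<gamma> N))\<^sup>2
      = L / 2 * (norm (x0 - xs))\<^sup>2 + \<gamma> N \<bullet> (xs - x0) + 1 / (2 * L) * (norm (\<gamma> N))\<^sup>2"
    using L by (simp add: distrib_left add_divide_distrib)
  then show ?thesis
    unfolding U V squares inner_scaleR_right sum_distrib_left[symmetric] bilinear_anti_transpose
    by linarith
qed

theorem theorem1:
  fixes L :: real and N :: nat and u v :: "nat \<Rightarrow> real" and H :: "nat \<Rightarrow> nat \<Rightarrow> real"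
  assumes "L > 0" and "N \<ge> 1"
    and "\<And>i. i \<le> N \<Longrightarrow> u i > 0" and "\<And>i. i \<le> N \<Longrightarrow> v i > 0"
    and "\<And>i. i \<le> N \<Longrightarrow> v i = 1 / u (N - i)"
    and "lower_triangular N H"
  shows
    "(\<forall>(x0 :: real ^ 'd) (xs :: real ^ 'd) (g :: nat \<Rightarrow> real ^ 'd) (f :: nat \<Rightarrow> real) (fs :: real).
        u N * (f N - fs) \<le> U_bound L N u (fsfom L H g x0) xs g f fs)
     \<longleftrightarrow>
     (\<forall>(y0 :: real ^ 'd) (g :: nat \<Rightarrow> real ^ 'd) (f :: nat \<Rightarrow> real) (fs :: real).
        1 / (2 * L) * (norm (g N))\<^sup>2
          \<le> V_bound L N v (fsfom L (anti_transpose N H) g y0) g f fs)"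
proof (intro iffI allI)
  fix y0 :: "real ^ 'd" and \<gamma> :: "nat \<Rightarrow> real ^ 'd" and f :: "nat \<Rightarrow> real" and fs :: real
  assume a: "\<forall>(x0 :: real ^ 'd) xs g f fs. u N * (f N - fs) \<le> U_bound L N u (fsfom L H g x0) xs g f fs"
  obtain g where "dual_gradients N u g \<gamma>"
    using dual_gradients_left_exists[of N u \<gamma>] assms(3) by force
  \<comment> \<open>The choice \<open>x0 = 0\<close>,
    \<open>xs = - (1 / L) *\<^sub>R \<gamma> N\<close> makes the square vanish, so the two gaps
    coincide.\<close>
  then show "1 / (2 * L) * (norm (\<gamma> N))\<^sup>2 \<le> V_bound L N v (fsfom L (anti_transpose N H) \<gamma> y0) \<gamma> f fs"
    using U_gap_eq_V_gap[of L N u v g \<gamma> H 0 "- (1 / L) *\<^sub>R \<gamma> N" f fs y0 f fs] assms(1,3,5)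
      spec[OF spec[OF spec[OF spec[OF spec[OF a, of 0], of "- (1 / L) *\<^sub>R \<gamma> N"], of g], of f], of fs]
    by simp
next
  fix x0 xs :: "real ^ 'd" and g :: "nat \<Rightarrow> real ^ 'd" and f :: "nat \<Rightarrow> real" and fs :: real
  assume b: "\<forall>(y0 :: real ^ 'd) g f fs. 1 / (2 * L) * (norm (g N))\<^sup>2
    \<le> V_bound L N v (fsfom L (anti_transpose N H) g y0) g f fs"
  obtain \<gamma> where "dual_gradients N u g \<gamma>"
    using dual_gradients_right_exists by blast
  \<comment> \<open>Any starting point works for the dual method, here \<open>0\<close>; the square
    only enlarges the gap in (a).\<close>
  then have "U_bound L N u (fsfom L H g x0) xs g f fs - u N * (f N - fs)
    = V_bound L N v (fsfom L (anti_transpose N H) \<gamma> 0) \<gamma> f fs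
      - 1 / (2 * L) * (norm (\<gamma> N))\<^sup>2 + L / 2 * (norm (x0 - xs - (1 / L) *\<^sub>R \<gamma> N))\<^sup>2"
    using U_gap_eq_V_gap assms(1,3,5) by blast
  moreover have "0 \<le> L / 2 * (norm (x0 - xs - (1 / L) *\<^sub>R \<gamma> N))\<^sup>2"
    using assms(1) by simp
  ultimately show "u N * (f N - fs) \<le> U_bound L N u (fsfom L H g x0) xs g f fs"
    using spec[OF spec[OF spec[OF spec[OF b, of 0], of \<gamma>], of f], of fs]
    by linarith
qed

end
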